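(* Let $X$ be an Archimedean pervasive pre-Riesz space with a vector lattice cover $(Y,i)$. Let $B\subseteq X$ be a band and let $\hat{B}\subseteq Y$ be an extension band of $B$. Then the following statements are equivalent: (i) $i(B)$ is majorizing in $\hat{B}$. (ii) $i(B)$ is order dense in $\hat{B}$. Moreover, if (i) or (ii) is satisfied, then $B$ is a pre-Riesz space and hence directed, $\hat{B}$ (together with $i|_B$) is a vector lattice cover of $B$, and $B$ is pervasive.
   Context: All ordered vector spaces are real vector spaces with a partial order given by a cone $X_+$ ($x\le y$ iff $y-x\in X_+$); linear subspaces carry the induced order. $X$ is Archimedean if $nx\le y$ for all $n\in\mathbb{N}$ implies $x\le 0$. A linear subspace $D$ is directed if any two elements of $D$ have an upper bound in $D$. A linear subspace $D$ of an ordered vector space $Z$ is majorizing in $Z$ if every $z\in Z$ satisfies $z\le d$ for some $d\in D$, and order dense in $Z$ if for every $z\in Z$ one has $z=\inf\{d\in D: z\le d\}$ (infimum in $Z$). A linear map $i$ is bipositive if $i(x)\ge 0\iff x\ge 0$. An ordered vector space $X$ is pre-Riesz if there are a vector lattice $Y$ and a bipositive linear map $i\colon X\to Y$ with $i(X)$ order dense in $Y$; then $(Y,i)$ is called a vector lattice cover of $X$. A pre-Riesz space $X$ is pervasive if for a vector lattice cover $(Y,i)$ (equivalently, for every vector lattice cover) and every $y\in Y_+$, $y\ne 0$, there is $x\in X$ with $0<i(x)\le y$. For $M\subseteq X$ let $M^u$ be the set of upper bounds of $M$ in $X$. Elements $x,y\in X$ are disjoint, $x\perp y$, if $\{x+y,-(x+y)\}^u=\{x-y,-(x-y)\}^u$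 (in a vector lattice this is the usual disjointness). For $M\subseteq X$, $M^{\mathrm d}=\{x\in X: x\perp y\text{ for all }y\in M\}$ and $M^{\mathrm{dd}}=(M^{\mathrm d})^{\mathrm d}$. A band is a linear subspace $B$ with $B=B^{\mathrm{dd}}$. A band $J$ of $Y$ is an extension band of a band $B$ of $X$ if $B=\{x\in X: i(x)\in J\}$. *)

theory Defs
  imports Complex_Main
begin

text \<open>
  An ordered vector space is a linear subspace (the carrier) of a type of class
  \<^class>\<open>ordered_real_vector\<close>, with the induced order. All order-theoretic notions
  (bounds, suprema, infima, disjointness) are taken relative to the carrier, so that
  a subspace can be treated as a space in its own right.
\<close>

definition archimedean :: "'a::ordered_real_vector set \<Rightarrow> bool" where
  "archimedean X \<longleftrightarrow> (\<forall>x\<in>X. \<forall>y\<in>X. (\<forall>n::nat. real n *\<^sub>R x \<le> y) \<longrightarrow> x \<le> 0)"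

definition directed :: "'a::ordered_real_vector set \<Rightarrow> bool" where
  "directed D \<longleftrightarrow> (\<forall>x\<in>D. \<forall>y\<in>D. \<exists>u\<in>D. x \<le> u \<and> y \<le> u)"

definition upper_bounds :: "'a::ordered_real_vector set \<Rightarrow> 'a set \<Rightarrow> 'a set" where
  "upper_bounds X M = {u \<in> X. \<forall>m\<in>M. m \<le> u}"

definition lower_bounds :: "'a::ordered_real_vector set \<Rightarrow> 'a set \<Rightarrow> 'a set" where
  "lower_bounds X M = {l \<in> X. \<forall>m\<in>M. l \<le> m}"

definition is_supremum :: "'a::ordered_real_vector set \<Rightarrow> 'a set \<Rightarrow> 'a \<Rightarrow> bool" where
  "is_supremum X M s \<longleftrightarrow> s \<in> upper_bounds X M \<and> (\<forall>u\<in>upper_bounds X M. s \<le> u)"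

definition is_infimum :: "'a::ordered_real_vector set \<Rightarrow> 'a set \<Rightarrow> 'a \<Rightarrow> bool" where
  "is_infimum X M s \<longleftrightarrow> s \<in> lower_bounds X M \<and> (\<forall>l\<in>lower_bounds X M. l \<le> s)"

definition majorizing :: "'a::ordered_real_vector set \<Rightarrow> 'a set \<Rightarrow> bool" where
  "majorizing D Z \<longleftrightarrow> subspace D \<and> D \<subseteq> Z \<and> (\<forall>z\<in>Z. \<exists>d\<in>D. z \<le> d)"

definition order_dense :: "'a::ordered_real_vector set \<Rightarrow> 'a set \<Rightarrow> bool" where
  "order_dense D Z \<longleftrightarrow> subspace D \<and> D \<subseteq> Z \<and> (\<forall>z\<in>Z. is_infimum Z {d \<in> D. z \<le> d} z)"

text \<open>
  The lattice operations are those of the induced order on the carrier; a vector lattice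
  need not be a sublattice of an ambient one.
\<close>

definition vector_lattice :: "'a::ordered_real_vector set \<Rightarrow> bool" where
  "vector_lattice Y \<longleftrightarrow> subspace Y \<and>
     (\<forall>x\<in>Y. \<forall>y\<in>Y. (\<exists>s. is_supremum Y {x, y} s) \<and> (\<exists>t. is_infimum Y {x, y} t))"

text \<open>
  Maps are total functions, of which only the values on the carrier matter. In particular,
  the restriction of a map to a subspace is represented by the map itself.
\<close>

definition linear_map_on ::
  "'a::ordered_real_vector set \<Rightarrow> 'b::ordered_real_vector set \<Rightarrow> ('a \<Rightarrow> 'b) \<Rightarrow> bool" where
  "linear_map_on X Y i \<longleftrightarrow> i ` X \<subseteq> Y \<and>
     (\<forall>x\<in>X. \<forall>y\<in>X. i (x + y) = i x + i y) \<and> (\<forall>x\<in>X. \<forall>c. i (c *\<^sub>R x) = c *\<^sub>R i x)"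

definition bipositive_on ::
  "'a::ordered_real_vector set \<Rightarrow> ('a \<Rightarrow> 'b::ordered_real_vector) \<Rightarrow> bool" where
  "bipositive_on X i \<longleftrightarrow> (\<forall>x\<in>X. 0 \<le> i x \<longleftrightarrow> 0 \<le> x)"

definition vector_lattice_cover ::
  "'a::ordered_real_vector set \<Rightarrow> 'b::ordered_real_vector set \<Rightarrow> ('a \<Rightarrow> 'b) \<Rightarrow> bool" where
  "vector_lattice_cover X Y i \<longleftrightarrow> subspace X \<and> vector_lattice Y \<and>
     linear_map_on X Y i \<and> bipositive_on X i \<and> order_dense (i ` X) Y"

text \<open>
  HOL cannot quantify existentially over types, so the type in which a vector lattice cover
  is sought is an explicit parameter. Hence a hypothesis \<open>pre_riesz TYPE('c) X\<close> with
  unconstrained \<open>'c\<close> asks for a cover in an arbitrary type, and a conclusion with a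
  specific type provides a cover in that type.
\<close>

definition pre_riesz ::
  "'b::ordered_real_vector itself \<Rightarrow> 'a::ordered_real_vector set \<Rightarrow> bool" where
  "pre_riesz T X \<longleftrightarrow> (\<exists>(Y :: 'b set) (i :: 'a \<Rightarrow> 'b). vector_lattice_cover X Y i)"

definition pervasive_space ::
  "'b::ordered_real_vector itself \<Rightarrow> 'a::ordered_real_vector set \<Rightarrow> bool" where
  "pervasive_space T X \<longleftrightarrow> (\<exists>(Y :: 'b set) (i :: 'a \<Rightarrow> 'b). vector_lattice_cover X Y i \<and>
     (\<forall>y\<in>Y. 0 \<le> y \<and> y \<noteq> 0 \<longrightarrow> (\<exists>x\<in>X. 0 < i x \<and> i x \<le> y)))"

definition ov_disjoint :: "'a::ordered_real_vector set \<Rightarrow> 'a \<Rightarrow> 'a \<Rightarrow> bool" where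
  "ov_disjoint X x y \<longleftrightarrow>
     upper_bounds X {x + y, - (x + y)} = upper_bounds X {x - y, - (x - y)}"

definition disjoint_complement :: "'a::ordered_real_vector set \<Rightarrow> 'a set \<Rightarrow> 'a set" where
  "disjoint_complement X M = {x \<in> X. \<forall>y\<in>M. ov_disjoint X x y}"

definition band :: "'a::ordered_real_vector set \<Rightarrow> 'a set \<Rightarrow> bool" where
  "band X B \<longleftrightarrow> subspace B \<and> B \<subseteq> X \<and>
     B = disjoint_complement X (disjoint_complement X B)"

definition extension_band ::
  "'a::ordered_real_vector set \<Rightarrow> 'b::ordered_real_vector set \<Rightarrow> ('a \<Rightarrow> 'b) \<Rightarrow>
   'a set \<Rightarrow> 'b set \<Rightarrow> bool" where
  "extension_band X Y i B J \<longleftrightarrow> band X B \<and> band Y J \<and> B = {x \<in> X. i x \<in> J}"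

end

theory Submission
  imports Defs
begin

text \<open>
  Pervasiveness passes from one cover to any other, because it can be read off inside \<open>X\<close>:
  below the elements majorizing both \<open>0\<close> and some \<open>b \<not>\<le> 0\<close> there is a strictly positive one.
  With the Archimedean property it follows that every \<open>y \<ge> 0\<close> in \<open>Y\<close> is the supremum of the
  elements of \<open>i ` X\<close> between \<open>0\<close> and \<open>y\<close>: otherwise, with a smaller upper bound \<open>z\<close> and
  \<open>0 < i x \<le> y - z\<close>, all multiples of \<open>i x\<close> would stay below \<open>y\<close>. If \<open>i ` B\<close> is majorizing
  and \<open>z \<le> i d\<close>, applying this to \<open>y = i d - z\<close> exhibits \<open>z\<close> as an infimum of elements \<open>i (d - x)\<close>;
  here \<open>x \<in> B\<close> because bands are solid.
\<close>

section \<open>Linear and bipositive maps on subspaces, and order density\<close>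

lemma linear_map_on_diff:
  assumes "subspace X" "linear_map_on X Y i" "x \<in> X" "y \<in> X"
  shows "i (x - y) = i x - i y"
proof -
  have "i (x + (-1) *\<^sub>R y) = i x + i ((-1) *\<^sub>R y)"
    using assms by (meson linear_map_on_def subspace_scale)
  also have "i ((-1) *\<^sub>R y) = (-1) *\<^sub>R i y"
    using assms by (meson linear_map_on_def)
  finally show ?thesis by simp
qed

lemma linear_map_on_image_subspace:
  assumes "subspace X" "linear_map_on X Y i"
  shows "subspace (i ` X)"
proof (rule subspaceI)
  have "i (0 - 0) = i 0 - i 0"
    using assms by (intro linear_map_on_diff) (auto simp: subspace_0)
  then show "0 \<in> i ` X"
    using subspace_0[OF assms(1)] by force
next
  fix u v assume "u \<in> i ` X" "v \<in> i ` X"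
  then obtain x y where "x \<in> X" "y \<in> X" "u = i x" "v = i y" by blast
  moreover from this have "i (x + y) = u + v"
    using assms by (simp add: linear_map_on_def)
  ultimately show "u + v \<in> i ` X"
    using subspace_add[OF assms(1)] by (metis imageI)
next
  fix c u assume "u \<in> i ` X"
  then obtain x where "x \<in> X" "u = i x" by blast
  moreover from this have "i (c *\<^sub>R x) = c *\<^sub>R u"
    using assms by (simp add: linear_map_on_def)
  ultimately show "c *\<^sub>R u \<in> i ` X"
    using subspace_scale[OF assms(1)] by (metis imageI)
qed

lemma linear_map_on_subset:
  assumes "linear_map_on X Y i" "B \<subseteq> X" "i ` B \<subseteq> Z"
  shows "linear_map_on B Z i"
  using assms unfolding linear_map_on_def by blast

lemma bipositive_on_le_iff:
  assumes "subspace X" "linear_map_on X Y i" "bipositive_on X i" "x \<in> X" "y \<in> X"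
  shows "i x \<le> i y \<longleftrightarrow> x \<le> y"
proof -
  have "0 \<le> i (y - x) \<longleftrightarrow> 0 \<le> y - x"
    using assms(1,3-5) by (simp add: bipositive_on_def subspace_diff)
  then show ?thesis
    using linear_map_on_diff[OF assms(1,2,5,4)] by simp
qed

text \<open>The point is that no \<open>z\<close> can be the infimum of the empty set unless \<open>Z\<close> is trivial.\<close>

lemma order_dense_imp_majorizing:
  assumes "subspace Z" "order_dense D Z"
  shows "majorizing D Z"
proof -
  have "\<exists>d\<in>D. z \<le> d" if z: "z \<in> Z" for z
  proof (rule ccontr)
    assume no: "\<not> (\<exists>d\<in>D. z \<le> d)"
    then have "{d \<in> D. z \<le> d} = {}" by blast
    moreover have "is_infimum Z {d \<in> D. z \<le> d} z"
      using assms(2) z by (simp add: order_dense_def)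
    ultimately have top: "l \<le> z" if "l \<in> Z" for l
      using that no by (auto simp: is_infimum_def lower_bounds_def)
    \<comment> \<open>Being the greatest element of \<open>Z\<close>, \<open>z\<close> dominates its
      own double and is thus \<open>\<le> 0\<close>; so \<open>0\<close> in \<open>D\<close>
      majorizes it after all.\<close>
    have "z + z \<le> z" using z assms(1) by (intro top subspace_add)
    then have "z \<le> 0" by simp
    moreover have "0 \<in> D"
      using assms(2) by (simp add: order_dense_def subspace_0)
    ultimately show False using no by blast
  qed
  then show ?thesis
    using assms(2) by (simp add: order_dense_def majorizing_def)
qed

lemma order_dense_le:
  assumes "order_dense D Z" "z \<in> Z" "l \<in> Z" "\<And>d. d \<in> D \<Longrightarrow> z \<le> d \<Longrightarrow> l \<le> d"
  shows "l \<le> z"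
proof -
  have "is_infimum Z {d \<in> D. z \<le> d} z"
    using assms(1,2) by (simp add: order_dense_def)
  then show ?thesis
    using assms(3,4) by (auto simp: is_infimum_def lower_bounds_def)
qed

text \<open>Both \<open>Z\<close> and \<open>D\<close> are closed under negation, so approximation
  from above turns into approximation from below.\<close>

lemma order_dense_ge:
  assumes "subspace Z" "order_dense D Z" "z \<in> Z" "u \<in> Z"
    and le: "\<And>d. d \<in> D \<Longrightarrow> d \<le> z \<Longrightarrow> d \<le> u"
  shows "z \<le> u"
proof -
  have D: "subspace D" using assms(2) by (simp add: order_dense_def)
  have "- u \<le> - z"
  proof (rule order_dense_le[OF assms(2)])
    show "- z \<in> Z" "- u \<in> Z" using assms(1,3,4) by (simp_all add: subspace_neg)
    show "- u \<le> d" if "d \<in> D" "- z \<le> d" for d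
      using le[of "- d"] subspace_neg[OF D] that by (simp add: minus_le_iff)
  qed
  then show ?thesis by simp
qed

section \<open>Pervasiveness and its independence of the cover\<close>

text \<open>In a pervasive cover the positive part of the image of \<open>b\<close> is nonzero,
  hence dominates the image of some \<open>x > 0\<close>. It lies below the image of each
  \<open>d\<close> that majorizes \<open>0\<close> and \<open>b\<close>, and the conclusion no
  longer mentions a cover.\<close>

lemma pervasive_space_intrinsic:
  assumes "pervasive_space TYPE('c::ordered_real_vector) X" "b \<in> X" "\<not> b \<le> 0"
  obtains x where "x \<in> X" "0 < x" "\<And>d. d \<in> X \<Longrightarrow> 0 \<le> d \<Longrightarrow> b \<le> d \<Longrightarrow> x \<le> d"
proof -
  from assms(1) obtain Z :: "'c set" and j where cov: "vector_lattice_cover X Z j"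
    and perv: "\<And>z. z \<in> Z \<Longrightarrow> 0 \<le> z \<Longrightarrow> z \<noteq> 0 \<Longrightarrow> \<exists>x\<in>X. 0 < j x \<and> j x \<le> z"
    unfolding pervasive_space_def by blast
  have X: "subspace X" and Z: "vector_lattice Z" "subspace Z"
    and j: "linear_map_on X Z j" "bipositive_on X j"
    using cov by (auto simp: vector_lattice_cover_def vector_lattice_def)
  note le_iff = bipositive_on_le_iff[OF X j]
  have 0: "0 \<in> X" "0 \<in> Z" using X Z by (simp_all add: subspace_0)
  have j0: "j 0 = 0" using linear_map_on_diff[OF X j(1) 0(1) 0(1)] by simp
  have jb: "j b \<in> Z" using j(1) assms(2) by (auto simp: linear_map_on_def)
  obtain s where s: "is_supremum Z {0, j b} s"
    using Z 0 jb by (auto simp: vector_lattice_def)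
  have "s \<in> Z" "0 \<le> s" "j b \<le> s"
    using s by (auto simp: is_supremum_def upper_bounds_def)
  moreover from this have "s \<noteq> 0"
    using assms(2,3) le_iff[of b 0] 0 j0 by auto
  ultimately obtain x where x: "x \<in> X" "0 < j x" "j x \<le> s"
    using perv by blast
  show ?thesis
  proof
    show "x \<in> X" by fact
    show "0 < x" using x le_iff[of 0 x] le_iff[of x 0] 0 j0 by (simp add: less_le_not_le)
    show "x \<le> d" if "d \<in> X" "0 \<le> d" "b \<le> d" for d
    proof -
      have "0 \<le> j d" "j b \<le> j d" "j d \<in> Z"
        using that le_iff[of 0 d] le_iff[of b d] 0 j0 assms(2) j(1)
        by (auto simp: linear_map_on_def)
      then have "s \<le> j d" using s by (simp add: is_supremum_def upper_bounds_def)
      then show ?thesis using x that le_iff[of x d] by (meson order_trans)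
    qed
  qed
qed

text \<open>Approximating \<open>y\<close> from below gives \<open>b\<close> with
  \<open>i b \<le> y\<close> but not \<open>i b \<le> 0\<close>. A majorant of \<open>y\<close> in
  the image of \<open>X\<close> comes from an element above \<open>0\<close> and \<open>b\<close>,
  hence above the intrinsic \<open>x\<close>; order density then gives
  \<open>i x \<le> y\<close>.\<close>

lemma pervasive_space_cover:
  assumes "pervasive_space TYPE('c::ordered_real_vector) X" "vector_lattice_cover X Y i"
    and y: "y \<in> Y" "0 \<le> y" "y \<noteq> 0"
  obtains x where "x \<in> X" "0 < i x" "i x \<le> y"
proof -
  have X: "subspace X" and Y: "subspace Y" and i: "linear_map_on X Y i" "bipositive_on X i"
    and dense: "order_dense (i ` X) Y"
    using assms(2) by (auto simp: vector_lattice_cover_def vector_lattice_def)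
  note le_iff = bipositive_on_le_iff[OF X i]
  have 0: "0 \<in> X" "0 \<in> Y" using X Y by (simp_all add: subspace_0)
  have i0: "i 0 = 0" using linear_map_on_diff[OF X i(1) 0(1) 0(1)] by simp
  have "\<not> y \<le> 0" using y by auto
  then obtain b where b: "b \<in> X" "i b \<le> y" "\<not> i b \<le> 0"
    using order_dense_ge[OF Y dense y(1) 0(2)] by blast
  then have "\<not> b \<le> 0" using le_iff[of b 0] 0 i0 by simp
  then obtain x where x: "x \<in> X" "0 < x" "\<And>d. d \<in> X \<Longrightarrow> 0 \<le> d \<Longrightarrow> b \<le> d \<Longrightarrow> x \<le> d"
    using pervasive_space_intrinsic[OF assms(1) b(1)] by metis
  show ?thesis
  proof
    show "x \<in> X" by fact
    show "0 < i x" using x le_iff[of 0 x] le_iff[of x 0] 0 i0 by auto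
    show "i x \<le> y"
    proof (rule order_dense_le[OF dense y(1)])
      show "i x \<in> Y" using i x by (auto simp: linear_map_on_def)
      fix d assume "d \<in> i ` X" "y \<le> d"
      then obtain e where e: "e \<in> X" "d = i e" by blast
      then have "0 \<le> e" "b \<le> e"
        using \<open>y \<le> d\<close> y b le_iff[of 0 e] le_iff[of b e] 0 i0 by (auto intro: order_trans)
      then show "i x \<le> d" using x e le_iff[of x e] by simp
    qed
  qed
qed

lemma archimedean_pervasive_is_supremum:
  assumes "archimedean X" "pervasive_space TYPE('c::ordered_real_vector) X"
    and "vector_lattice_cover X Y i" and y: "y \<in> Y" "0 \<le> y"
  shows "is_supremum Y {u \<in> i ` X. 0 \<le> u \<and> u \<le> y} y"
proof -
  have X: "subspace X" and Y: "vector_lattice Y" "subspace Y"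
    and i: "linear_map_on X Y i" "bipositive_on X i" and dense: "order_dense (i ` X) Y"
    using assms(3) by (auto simp: vector_lattice_cover_def vector_lattice_def)
  note le_iff = bipositive_on_le_iff[OF X i]
  note iX = linear_map_on_image_subspace[OF X i(1)]
  have 0: "0 \<in> X" using X by (rule subspace_0)
  have i0: "i 0 = 0" using linear_map_on_diff[OF X i(1) 0 0] by simp
  have "y \<le> u" if u: "u \<in> Y" and ub: "\<And>v. v \<in> i ` X \<Longrightarrow> 0 \<le> v \<Longrightarrow> v \<le> y \<Longrightarrow> v \<le> u" for u
  proof (rule ccontr)
    assume "\<not> y \<le> u"
    \<comment> \<open>The meet replaces \<open>u\<close> so that \<open>y - z\<close> is positive;
      it is nonzero because \<open>y\<close> is not below \<open>u\<close>.\<close>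
    obtain z where "is_infimum Y {u, y} z"
      using Y u y by (auto simp: vector_lattice_def)
    then have z: "z \<in> Y" "z \<le> u" "z \<le> y" and glb: "\<And>l. l \<in> Y \<Longrightarrow> l \<le> u \<Longrightarrow> l \<le> y \<Longrightarrow> l \<le> z"
      by (auto simp: is_infimum_def lower_bounds_def)
    have "y - z \<in> Y" "0 \<le> y - z" "y - z \<noteq> 0"
      using z y Y \<open>\<not> y \<le> u\<close> by (auto simp: subspace_diff)
    then obtain x where x: "x \<in> X" "0 < i x" "i x \<le> y - z"
      using pervasive_space_cover[OF assms(2,3)] by metis
    have mult: "real n *\<^sub>R i x \<le> y" for n
    proof (induction n)
      case 0
      show ?case using y by simp
    next
      \<comment> \<open>A multiple below \<open>y\<close> is among the elements bounded by
        \<open>u\<close>, hence lies below the meet \<open>z\<close>; this leaves room for one more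
        \<open>i x\<close>.\<close>
      case (Suc n)
      have mem: "real n *\<^sub>R i x \<in> i ` X" using iX x by (simp add: subspace_scale)
      moreover have "0 \<le> real n *\<^sub>R i x" using x by (simp add: scaleR_nonneg_nonneg)
      ultimately have "real n *\<^sub>R i x \<le> u" using ub Suc by blast
      moreover have "real n *\<^sub>R i x \<in> Y" using mem dense by (auto simp: order_dense_def)
      ultimately have "real n *\<^sub>R i x \<le> z" using glb Suc by blast
      then have "i x + real n *\<^sub>R i x \<le> (y - z) + z" using x by (intro add_mono)
      then show ?case by (simp add: scaleR_add_left)
    qed
    \<comment> \<open>The Archimedean property is available in \<open>X\<close>, so \<open>y\<close>
      is replaced by a majorant from there.\<close>
    obtain d where d: "d \<in> X" "y \<le> i d"
      using order_dense_imp_majorizing[OF Y(2) dense] y by (auto simp: majorizing_def)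
    have "real n *\<^sub>R x \<le> d" for n
    proof -
      have "i (real n *\<^sub>R x) = real n *\<^sub>R i x" using i x by (simp add: linear_map_on_def)
      also have "\<dots> \<le> i d" using mult d by (meson order_trans)
      finally show ?thesis using le_iff X x d by (simp add: subspace_scale)
    qed
    then have "x \<le> 0" using assms(1) x d by (auto simp: archimedean_def)
    then show False using x le_iff[of x 0] 0 i0 by auto
  qed
  then show ?thesis using y by (auto simp: is_supremum_def upper_bounds_def)
qed

section \<open>Disjointness and bands\<close>

text \<open>
  If \<open>p\<close> is an upper bound of \<open>u + w\<close> and \<open>- (u + w)\<close>, then \<open>p + (v - u)\<close> is one of
  \<open>v + w\<close> and \<open>- (v + w)\<close>, to which the disjointness of \<open>v\<close> and \<open>w\<close> applies.
\<close>

lemma ov_disjoint_solid: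
  assumes "subspace Y" "u \<in> Y" "v \<in> Y" "0 \<le> u" "u \<le> v" "ov_disjoint Y v w"
  shows "ov_disjoint Y u w"
proof -
  have iff: "v + w \<le> p \<and> - (v + w) \<le> p \<longleftrightarrow> v - w \<le> p \<and> - (v - w) \<le> p" if "p \<in> Y" for p
    using assms(6) that unfolding ov_disjoint_def upper_bounds_def set_eq_iff by auto
  \<comment> \<open>One inclusion is proved for a general \<open>w'\<close>; taking \<open>w\<close>
    and \<open>- w\<close> for it gives the two directions of the equivalence.\<close>
  have key: "u - w' \<le> p \<and> - (u - w') \<le> p"
    if p: "p \<in> Y" "u + w' \<le> p" "- (u + w') \<le> p"
      and w': "\<And>q. q \<in> Y \<Longrightarrow> v + w' \<le> q \<Longrightarrow> - (v + w') \<le> q \<Longrightarrow> v - w' \<le> q"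
    for p w'
  proof
    have "v - w' \<le> p + (v - u)"
    proof (rule w')
      show "p + (v - u) \<in> Y" using assms p by (simp add: subspace_add subspace_diff)
      show "v + w' \<le> p + (v - u)" using p(2) by (simp add: algebra_simps)
      have "- (u + w') + (u - v) \<le> p + (v - u)"
        using p(3) assms(5) by (intro add_mono) (auto intro: order_trans[of _ 0])
      then show "- (v + w') \<le> p + (v - u)" by (simp add: algebra_simps)
    qed
    then show "u - w' \<le> p" by (simp add: algebra_simps)
    have "- u + w' \<le> u + w'" using assms(4) by (intro add_right_mono) (auto intro: order_trans[of _ 0])
    then have "- u + w' \<le> p" using p(2) by (rule order_trans)
    then show "- (u - w') \<le> p" by simp
  qed
  have "u + w \<le> p \<and> - (u + w) \<le> p \<longleftrightarrow> u - w \<le> p \<and> - (u - w) \<le> p" if "p \<in> Y" for p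
    using key[of p w] key[of p "- w"] iff that by auto
  then show ?thesis
    unfolding ov_disjoint_def upper_bounds_def by auto
qed

text \<open>A band is a double disjoint complement, and disjointness from each member of the first
  complement passes down from \<open>v\<close> to \<open>u\<close>.\<close>

lemma band_solid:
  assumes "subspace Y" "band Y J" "v \<in> J" "u \<in> Y" "0 \<le> u" "u \<le> v"
  shows "u \<in> J"
proof -
  have J: "J \<subseteq> Y" "J = disjoint_complement Y (disjoint_complement Y J)"
    using assms(2) by (simp_all add: band_def)
  have "ov_disjoint Y u w" if "w \<in> disjoint_complement Y J" for w
  proof (rule ov_disjoint_solid[OF assms(1,4) _ assms(5,6)])
    show "v \<in> Y" using J assms(3) by blast
    show "ov_disjoint Y v w"
      using assms(3) that J(2) unfolding disjoint_complement_def by blast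
  qed
  then have "u \<in> disjoint_complement Y (disjoint_complement Y J)"
    using assms(4) by (simp add: disjoint_complement_def[of Y "disjoint_complement Y J"])
  then show ?thesis using J(2) by simp
qed

text \<open>
  The supremum of \<open>v + w\<close> and \<open>- (v + w)\<close> is also that of \<open>v - w\<close> and \<open>- (v - w)\<close>. The hypotheses on \<open>m\<close>
  say \<open>m \<le> 2v\<^sup>+\<close> and \<open>m \<le> 2w\<^sup>-\<close>; then subtracting \<open>m\<close> from this supremum leaves an upper bound.
\<close>

lemma ov_disjoint_nonpos:
  assumes "vector_lattice Y" "v \<in> Y" "w \<in> Y" "m \<in> Y" "ov_disjoint Y v w"
    and mv: "\<And>e. e \<in> Y \<Longrightarrow> 0 \<le> e \<Longrightarrow> v + v \<le> e \<Longrightarrow> m \<le> e"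
    and mw: "\<And>e. e \<in> Y \<Longrightarrow> 0 \<le> e \<Longrightarrow> - (w + w) \<le> e \<Longrightarrow> m \<le> e"
  shows "m \<le> 0"
proof -
  have Y: "subspace Y" using assms(1) by (simp add: vector_lattice_def)
  have vw: "v + w \<in> Y" "- (v + w) \<in> Y"
    using Y assms(2,3) by (blast intro: subspace_add subspace_neg)+
  then obtain q where "is_supremum Y {v + w, - (v + w)} q"
    using assms(1) unfolding vector_lattice_def by blast
  then have q: "q \<in> Y" "v + w \<le> q" "- (v + w) \<le> q"
    and lub: "\<And>u. u \<in> Y \<Longrightarrow> v + w \<le> u \<Longrightarrow> - (v + w) \<le> u \<Longrightarrow> q \<le> u"
    by (auto simp: is_supremum_def upper_bounds_def)
  have "q \<in> upper_bounds Y {v - w, - (v - w)}"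
    using q assms(5) by (auto simp: ov_disjoint_def upper_bounds_def)
  then have q': "v - w \<le> q" by (simp add: upper_bounds_def)
  \<comment> \<open>By \<open>q'\<close>, \<open>q - (v + w)\<close> majorizes
    \<open>- (w + w)\<close> and \<open>q + (v + w)\<close> majorizes \<open>v + v\<close>; both are
    positive, so \<open>m\<close> lies below each.\<close>
  have "m \<le> q - (v + w)"
  proof (rule mw)
    show "q - (v + w) \<in> Y" using Y q(1) vw(1) by (rule subspace_diff)
  qed (use q q' in \<open>simp_all add: algebra_simps\<close>)
  moreover have "m \<le> q + (v + w)"
  proof (rule mv)
    show "q + (v + w) \<in> Y" using Y q(1) vw(1) by (rule subspace_add)
    have "- (v + w) + (v + w) \<le> q + (v + w)" using q(3) by (rule add_right_mono)
    then show "0 \<le> q + (v + w)" by simp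
  qed (use q' in \<open>simp add: algebra_simps\<close>)
  moreover have "q - m \<in> Y" using Y q(1) assms(4) by (rule subspace_diff)
  ultimately have "q \<le> q - m"
    by (intro lub) (simp_all add: algebra_simps)
  then show ?thesis by simp
qed

text \<open>If \<open>p\<close> is an upper bound of \<open>a + w\<close> and its negative, then
  \<open>a \<le> p + w\<close> can be tested on \<open>v\<close> and \<open>0\<close>, whose
  supremum is \<open>a\<close>. Both tests are instances of \<open>ov_disjoint_nonpos\<close>, with
  \<open>m\<close> equal to \<open>v - p - w\<close> and \<open>- p - w\<close>.\<close>

lemma ov_disjoint_positive_part:
  assumes "vector_lattice Y" "v \<in> Y" "w \<in> Y" "ov_disjoint Y v w"
    and a: "is_supremum Y {v, 0} a"
  shows "ov_disjoint Y a w"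
proof -
  have Y: "subspace Y" using assms(1) by (simp add: vector_lattice_def)
  have a_ub: "a \<in> Y" "v \<le> a" "0 \<le> a" and lub: "\<And>u. u \<in> Y \<Longrightarrow> v \<le> u \<Longrightarrow> 0 \<le> u \<Longrightarrow> a \<le> u"
    using a by (auto simp: is_supremum_def upper_bounds_def)
  \<comment> \<open>\<open>a + a\<close> is the least majorant of \<open>0\<close> and
    \<open>v + v\<close>, so the condition on \<open>v + v\<close> in
    \<open>ov_disjoint_nonpos\<close> reduces to \<open>m \<le> a + a\<close>.\<close>
  have aa: "a + a \<le> e" if e: "e \<in> Y" "0 \<le> e" "v + v \<le> e" for e
  proof -
    have "v = (1/2) *\<^sub>R (v + v)" by (simp flip: scaleR_2)
    also have "\<dots> \<le> (1/2) *\<^sub>R e" using e(3) by (rule scaleR_left_mono) simp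
    finally have "a \<le> (1/2) *\<^sub>R e"
      using e Y by (intro lub) (auto simp: subspace_scale scaleR_nonneg_nonneg)
    then have "a + a \<le> (1/2) *\<^sub>R e + (1/2) *\<^sub>R e" by (intro add_mono)
    then show ?thesis by (simp flip: scaleR_add_left)
  qed
  have key: "a - w' \<le> p \<and> - (a - w') \<le> p"
    if p: "p \<in> Y" "a + w' \<le> p" "- (a + w') \<le> p" and w': "w' \<in> Y" "ov_disjoint Y v w'"
    for p w'
  proof
    have "a + w' + - (a + w') \<le> p + p" using p(2,3) by (rule add_mono)
    then have "(1/2) *\<^sub>R 0 \<le> (1/2) *\<^sub>R (p + p)" by (intro scaleR_left_mono) auto
    then have p0: "0 \<le> p" by (simp flip: scaleR_2)
    have pa: "- p - w' \<le> a" using add_right_mono[OF p(3), of "a - p"] by (simp add: algebra_simps)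
    have pw: "w' \<le> p" using add_mono[OF a_ub(3) order_refl, of w'] p(2) unfolding add_0_left by (rule order_trans)
    have pv: "v + w' \<le> p" using add_right_mono[OF a_ub(2), of w'] p(2) by (rule order_trans)
    have ww: "- w' \<le> e" if e: "0 \<le> e" "- (w' + w') \<le> e" for e
    proof -
      have "(1/2) *\<^sub>R (- (w' + w')) \<le> (1/2) *\<^sub>R e" using e(2) by (intro scaleR_left_mono) auto
      also have "\<dots> \<le> 1 *\<^sub>R e" using e(1) by (intro scaleR_right_mono) auto
      finally show ?thesis by (simp flip: scaleR_2)
    qed
    have "- p - w' \<le> 0"
    proof (rule ov_disjoint_nonpos[OF assms(1,2) w'(1) _ w'(2)])
      show "- p - w' \<in> Y" using Y p w' by (simp add: subspace_diff subspace_neg)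
      show "- p - w' \<le> e" if "e \<in> Y" "0 \<le> e" "v + v \<le> e" for e
        using order_trans[OF add_mono[OF pa a_ub(3)] aa[OF that]] by simp
      show "- p - w' \<le> e" if "e \<in> Y" "0 \<le> e" "- (w' + w') \<le> e" for e
        using add_mono[OF le_imp_neg_le[OF p0] ww[OF that(2,3)]] by simp
    qed
    then have "0 \<le> p + w'" using neg_0_le_iff_le[of "- p - w'"] by (simp add: add.commute)
    \<comment> \<open>Here \<open>- p - w' \<le> a\<close> and \<open>v \<le> a\<close> give the
      bound by \<open>a + a\<close>, while \<open>v + w' \<le> p\<close> gives the one by
      \<open>- (w' + w')\<close>.\<close>
    moreover have "v - p - w' \<le> 0"
    proof (rule ov_disjoint_nonpos[OF assms(1,2) w'(1) _ w'(2)])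
      show "v - p - w' \<in> Y" using Y p w' assms(2) by (simp add: subspace_diff)
      show "v - p - w' \<le> e" if "e \<in> Y" "0 \<le> e" "v + v \<le> e" for e
        using order_trans[OF add_mono[OF pa a_ub(2)] aa[OF that]] by (simp add: algebra_simps)
      show "v - p - w' \<le> e" if "e \<in> Y" "0 \<le> e" "- (w' + w') \<le> e" for e
        using add_mono[OF pv that(3)] by (simp add: algebra_simps)
    qed
    then have "v \<le> p + w'" by (simp add: algebra_simps)
    moreover have "p + w' \<in> Y" using Y p(1) w'(1) by (rule subspace_add)
    ultimately have "a \<le> p + w'" by (intro lub)
    then show "a - w' \<le> p" by (simp add: algebra_simps)
    show "- (a - w') \<le> p" using add_mono[OF pw a_ub(3)] by (simp add: algebra_simps)
  qed
  \<comment> \<open>Negating \<open>w\<close> exchanges the two sets in the definition of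
    disjointness, so \<open>key\<close> at \<open>- w\<close> yields the converse direction.\<close>
  have "ov_disjoint Y v (- w)" using assms(4) by (simp add: ov_disjoint_def)
  then have "a + w \<le> p \<and> - (a + w) \<le> p \<longleftrightarrow> a - w \<le> p \<and> - (a - w) \<le> p" if "p \<in> Y" for p
    using key[of p w] key[of p "- w"] assms(3,4) Y that by (auto simp: subspace_neg)
  then show ?thesis
    unfolding ov_disjoint_def upper_bounds_def by auto
qed

text \<open>The positive part \<open>a\<close> of \<open>y - x\<close> inherits disjointness from
  the complement of \<open>J\<close>, so it stays in \<open>J\<close>, and \<open>x + a\<close>
  bounds both elements.\<close>

lemma band_directed:
  assumes "vector_lattice Y" "band Y J"
  shows "directed J"
  unfolding directed_def
proof (intro ballI)
  fix x y assume xy: "x \<in> J" "y \<in> J"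
  have J: "subspace J" "J \<subseteq> Y" "J = disjoint_complement Y (disjoint_complement Y J)"
    using assms(2) by (simp_all add: band_def)
  have Y: "subspace Y" using assms(1) by (simp add: vector_lattice_def)
  define v where "v = y - x"
  have v: "v \<in> J" using J(1) xy by (simp add: v_def subspace_diff)
  then obtain a where a: "is_supremum Y {v, 0} a"
    using assms(1) J(2) subspace_0[OF Y] unfolding vector_lattice_def by blast
  then have a_ub: "a \<in> Y" "v \<le> a" "0 \<le> a"
    by (auto simp: is_supremum_def upper_bounds_def)
  have "ov_disjoint Y a w" if w: "w \<in> disjoint_complement Y J" for w
  proof (rule ov_disjoint_positive_part[OF assms(1) _ _ _ a])
    show "v \<in> Y" using v J(2) by blast
    show "w \<in> Y" using w by (simp add: disjoint_complement_def)
    show "ov_disjoint Y v w"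
      using v w J(3) unfolding disjoint_complement_def by blast
  qed
  then have "a \<in> disjoint_complement Y (disjoint_complement Y J)"
    using a_ub(1) by (simp add: disjoint_complement_def[of Y "disjoint_complement Y J"])
  then have "x + a \<in> J" using J xy by (simp add: subspace_add)
  moreover have "x \<le> x + a" "y \<le> x + a"
    using a_ub by (simp_all add: v_def algebra_simps)
  ultimately show "\<exists>u\<in>J. x \<le> u \<and> y \<le> u" by blast
qed

text \<open>The lattice operations of \<open>Y\<close> do not leave \<open>J\<close>: directedness
  puts the supremum \<open>s\<close> between \<open>x\<close> and some \<open>d\<close> in
  \<open>J\<close>, and solidity applied to \<open>s - x \<le> d - x\<close> gives \<open>s\<close>
  in \<open>J\<close>. The infimum is treated dually.\<close>

lemma band_vector_lattice:
  assumes Y: "vector_lattice Y" and J: "band Y J"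
  shows "vector_lattice J"
proof -
  have sub: "subspace Y" "subspace J" "J \<subseteq> Y"
    using Y J by (auto simp: vector_lattice_def band_def)
  have "(\<exists>s. is_supremum J {x, y} s) \<and> (\<exists>t. is_infimum J {x, y} t)"
    if xy: "x \<in> J" "y \<in> J" for x y
  proof
    have "x \<in> Y" "y \<in> Y" using xy sub by auto
    then obtain s where "is_supremum Y {x, y} s"
      using Y unfolding vector_lattice_def by blast
    then have s: "s \<in> Y" "x \<le> s" "y \<le> s"
      and lub: "\<And>u. u \<in> Y \<Longrightarrow> x \<le> u \<Longrightarrow> y \<le> u \<Longrightarrow> s \<le> u"
      by (auto simp: is_supremum_def upper_bounds_def)
    obtain d where d: "d \<in> J" "x \<le> d" "y \<le> d" using band_directed[OF Y J] xy by (auto simp: directed_def)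
    have "s \<le> d" using d sub(3) by (intro lub) auto
    have "s - x \<in> J"
    proof (rule band_solid[OF sub(1) J])
      show "d - x \<in> J" using sub(2) d(1) xy(1) by (rule subspace_diff)
      show "s - x \<in> Y" using sub(1) s(1) \<open>x \<in> Y\<close> by (rule subspace_diff)
    qed (use s \<open>s \<le> d\<close> in simp_all)
    then have "s - x + x \<in> J" using xy(1) by (rule subspace_add[OF sub(2)])
    then have "s \<in> J" by simp
    then show "\<exists>s. is_supremum J {x, y} s"
      using s lub sub by (auto simp: is_supremum_def upper_bounds_def)
  next
    have "x \<in> Y" "y \<in> Y" using xy sub by auto
    then obtain t where "is_infimum Y {x, y} t"
      using Y unfolding vector_lattice_def by blast
    then have t: "t \<in> Y" "t \<le> x" "t \<le> y"
      and glb: "\<And>l. l \<in> Y \<Longrightarrow> l \<le> x \<Longrightarrow> l \<le> y \<Longrightarrow> l \<le> t"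
      by (auto simp: is_infimum_def lower_bounds_def)
    \<comment> \<open>Directedness at \<open>- x\<close> and \<open>- y\<close> provides the common
      lower bound \<open>- d\<close> in \<open>J\<close>.\<close>
    obtain d where d: "d \<in> J" "- x \<le> d" "- y \<le> d"
      using band_directed[OF Y J] xy sub(2) by (meson directed_def subspace_neg)
    then have "- d \<le> x" "- d \<le> y" "- d \<in> J"
      using sub(2) by (simp_all add: minus_le_iff subspace_neg)
    then have "- d \<le> t" using sub(3) by (intro glb) auto
    have "x - t \<in> J"
    proof (rule band_solid[OF sub(1) J])
      show "x + d \<in> J" using sub(2) xy(1) d(1) by (rule subspace_add)
      show "x - t \<in> Y" using sub(1) \<open>x \<in> Y\<close> t(1) by (rule subspace_diff)
      show "x - t \<le> x + d" using add_left_mono[OF \<open>- d \<le> t\<close>, of "x + d - t"] by simp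
    qed (use t in simp)
    then have "x - (x - t) \<in> J" by (rule subspace_diff[OF sub(2) xy(1)])
    then have "t \<in> J" by simp
    then show "\<exists>t. is_infimum J {x, y} t"
      using t glb sub by (auto simp: is_infimum_def lower_bounds_def)
  qed
  then show ?thesis using sub by (simp add: vector_lattice_def)
qed

section \<open>Extension bands: order density, the induced cover, pervasiveness\<close>

lemma majorizing_imp_order_dense:
  assumes "archimedean X" "pervasive_space TYPE('c::ordered_real_vector) X"
    and "vector_lattice_cover X Y i" "extension_band X Y i B J" "majorizing (i ` B) J"
  shows "order_dense (i ` B) J"
proof -
  have X: "subspace X" and Y: "subspace Y" and i: "linear_map_on X Y i"
    using assms(3) by (auto simp: vector_lattice_cover_def vector_lattice_def)
  have J: "band Y J" "subspace J" "J \<subseteq> Y" and B: "subspace B" "B = {x \<in> X. i x \<in> J}"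
    using assms(4) by (auto simp: extension_band_def band_def)
  have "l \<le> z"
    if z: "z \<in> J" and l: "l \<in> J" "\<And>d. d \<in> i ` B \<Longrightarrow> z \<le> d \<Longrightarrow> l \<le> d" for z l
  proof -
    obtain d where d: "d \<in> B" "z \<le> i d" using assms(5) z by (auto simp: majorizing_def)
    have idz: "i d - z \<in> J" using d z B(2) J(2) by (simp add: subspace_diff)
    have "is_supremum Y {u \<in> i ` X. 0 \<le> u \<and> u \<le> i d - z} (i d - z)"
      using idz d J(3) by (intro archimedean_pervasive_is_supremum[OF assms(1-3)]) auto
    \<comment> \<open>The supremum is taken over the image of all of \<open>X\<close>, but solidity
      forces \<open>u\<close> into \<open>J\<close> and its preimage \<open>x\<close> into
      \<open>B\<close>. Hence \<open>i d - u\<close> is a majorant of \<open>z\<close> from the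
      image of \<open>B\<close>, and \<open>l\<close> lies below it.\<close>
    moreover have "u \<le> i d - l" if u: "u \<in> i ` X" "0 \<le> u" "u \<le> i d - z" for u
    proof -
      obtain x where x: "x \<in> X" "u = i x" using u by blast
      have "u \<in> Y" using u(1) i by (auto simp: linear_map_on_def)
      then have "u \<in> J" by (rule band_solid[OF Y J(1) idz _ u(2,3)])
      then have "x \<in> B" using x B(2) by simp
      then have "i (d - x) \<in> i ` B" using d(1) B(1) by (intro imageI subspace_diff)
      moreover have "i (d - x) = i d - u"
        using linear_map_on_diff[OF X i, of d x] x d B(2) by simp
      moreover have "z \<le> i d - u" using u(3) by (simp add: algebra_simps)
      ultimately have "l \<le> i d - u" using l(2) by simp
      then show ?thesis by (simp add: algebra_simps)
    qed
    moreover have "i d - l \<in> Y" using d l(1) B(2) J by (auto simp: subspace_diff)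
    ultimately have "i d - z \<le> i d - l" by (auto simp: is_supremum_def upper_bounds_def)
    then show ?thesis by simp
  qed
  then show ?thesis
    using assms(5) unfolding order_dense_def majorizing_def is_infimum_def lower_bounds_def
    by auto
qed

text \<open>Beyond restricting \<open>i\<close>, what has to be supplied is that a band is a vector
  lattice in its own right.\<close>

lemma order_dense_extension_band_cover:
  assumes "vector_lattice_cover X Y i" "extension_band X Y i B J" "order_dense (i ` B) J"
  shows "vector_lattice_cover B J i"
proof -
  have J: "band Y J" and "band X B" and eq: "B = {x \<in> X. i x \<in> J}"
    using assms(2) unfolding extension_band_def by blast+
  then have B: "subspace B" by (simp add: band_def)
  have sub: "B \<subseteq> X" "i ` B \<subseteq> J" unfolding eq by auto
  have "linear_map_on B J i"
    using linear_map_on_subset[of X Y i B J] assms(1) sub by (simp add: vector_lattice_cover_def)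
  moreover have "bipositive_on B i"
    using assms(1) sub(1) by (simp add: vector_lattice_cover_def bipositive_on_def subset_iff)
  moreover have "vector_lattice J"
    using band_vector_lattice[OF _ J] assms(1) by (simp add: vector_lattice_cover_def)
  ultimately show ?thesis
    using B assms(3) by (simp add: vector_lattice_cover_def)
qed

text \<open>The supremum of two images exists in \<open>Y\<close> and is majorized by some
  \<open>i u\<close>; bipositivity carries the bound back to \<open>X\<close>.\<close>

lemma vector_lattice_cover_directed:
  assumes "vector_lattice_cover X Y i"
  shows "directed X"
  unfolding directed_def
proof (intro ballI)
  fix x y assume xy: "x \<in> X" "y \<in> X"
  have X: "subspace X" and Y: "vector_lattice Y" "subspace Y"
    and i: "linear_map_on X Y i" "bipositive_on X i" and dense: "order_dense (i ` X) Y"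
    using assms by (auto simp: vector_lattice_cover_def vector_lattice_def)
  have "i x \<in> Y" "i y \<in> Y" using xy i(1) by (auto simp: linear_map_on_def)
  then obtain s where "is_supremum Y {i x, i y} s"
    using Y(1) unfolding vector_lattice_def by blast
  then have s: "s \<in> Y" "i x \<le> s" "i y \<le> s" by (auto simp: is_supremum_def upper_bounds_def)
  then obtain u where "u \<in> X" "s \<le> i u"
    using order_dense_imp_majorizing[OF Y(2) dense] by (auto simp: majorizing_def)
  then show "\<exists>u\<in>X. x \<le> u \<and> y \<le> u"
    using s xy bipositive_on_le_iff[OF X i] by (meson order_trans)
qed

text \<open>An element of \<open>X\<close> found below \<open>y\<close> has its image in
  \<open>J\<close> by solidity, which places it in \<open>B\<close>.\<close>

lemma extension_band_pervasive:
  assumes "pervasive_space TYPE('c::ordered_real_vector) X"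
    and "vector_lattice_cover X Y i" "extension_band X Y i B J" "y \<in> J" "0 \<le> y" "y \<noteq> 0"
  obtains x where "x \<in> B" "0 < i x" "i x \<le> y"
proof -
  have Y: "subspace Y" and i: "linear_map_on X Y i"
    using assms(2) by (auto simp: vector_lattice_cover_def vector_lattice_def)
  have J: "band Y J" and B: "B = {x \<in> X. i x \<in> J}"
    using assms(3) unfolding extension_band_def by blast+
  have "J \<subseteq> Y" using J by (simp add: band_def)
  then have "y \<in> Y" using assms(4) by (rule subsetD)
  from pervasive_space_cover[OF assms(1,2) \<open>y \<in> Y\<close> assms(5,6)]
  obtain x where x: "x \<in> X" "0 < i x" "i x \<le> y" .
  have "i x \<in> Y" using i x(1) by (auto simp: linear_map_on_def)
  then have "i x \<in> J"
    by (rule band_solid[OF Y J assms(4)]) (use x(2,3) in simp_all)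
  then have "x \<in> B" unfolding B using x(1) by simp
  then show ?thesis using x(2,3) by (rule that)
qed

theorem theorem31:
  fixes X B :: "'a::ordered_real_vector set"
    and Y B' :: "'b::ordered_real_vector set"
    and i :: "'a \<Rightarrow> 'b"
  assumes "subspace X"
    and "archimedean X"
    and "pre_riesz TYPE('c::ordered_real_vector) X"
    and "pervasive_space TYPE('c) X"
    and "vector_lattice_cover X Y i"
    and "band X B"
    and "extension_band X Y i B B'"
  shows "(majorizing (i ` B) B' \<longleftrightarrow> order_dense (i ` B) B') \<and>
    (majorizing (i ` B) B' \<or> order_dense (i ` B) B' \<longrightarrow>
       pre_riesz TYPE('b) B \<and> directed B \<and> vector_lattice_cover B B' i \<and>
       pervasive_space TYPE('b) B)"
proof (intro conjI impI)
  have J: "subspace B'" using assms(7) by (simp add: extension_band_def band_def)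
  show eq: "majorizing (i ` B) B' \<longleftrightarrow> order_dense (i ` B) B'"
    using majorizing_imp_order_dense[OF assms(2,4,5,7)] order_dense_imp_majorizing[OF J] by blast
  assume "majorizing (i ` B) B' \<or> order_dense (i ` B) B'"
  then have "order_dense (i ` B) B'" using eq by blast
  then show cover: "vector_lattice_cover B B' i"
    by (rule order_dense_extension_band_cover[OF assms(5,7)])
  then show "pre_riesz TYPE('b) B" by (auto simp: pre_riesz_def)
  show "directed B" using cover by (rule vector_lattice_cover_directed)
  \<comment> \<open>The witnessing cover is \<open>B'\<close> itself, which lives in type
    \<open>'b\<close>.\<close>
  show "pervasive_space TYPE('b) B"
    unfolding pervasive_space_def
    using cover extension_band_pervasive[OF assms(4,5,7)] by metis
qed

end
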